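(* Let $\alpha>0$, $\rho>0$ and $0\le a<b$. Let $f:[a^\rho,b^\rho]\to\mathbb{R}$ be a differentiable mapping. If $f'$ is differentiable on $(a^\rho,b^\rho)$, then $$ \left|\frac{f(a^\rho)+f(b^\rho)}{2} - \frac{\rho^\alpha \Gamma(\alpha+1)}{2(b^\rho-a^\rho)^\alpha}\left[ {}^\rho I^\alpha_{a+}f(b^{\rho})+ {}^\rho I^\alpha_{b-}f(a^{\rho})\right] \right| \leq \frac{(b^\rho - a^\rho)^2}{2(\alpha+1)(\alpha+2)}\Big(\alpha+\frac{1}{2^\alpha}\Big)\sup_{\xi\in(a^\rho,b^\rho)}\big|f''(\xi)\big|, $$ where the supremum may be $+\infty$ (in which case the inequality is trivial).
   Context: The left- and right-sided Katugampola fractional integrals of order $\alpha>0$ with parameter $\rho>0$ of a function $h$ on $[a,b]$ are $$ {}^\rho I^\alpha_{a+}h(x)=\frac{\rho^{1-\alpha}}{\Gamma(\alpha)}\int_a^x\frac{t^{\rho-1}}{(x^\rho-t^\rho)^{1-\alpha}}h(t)\,dt,\qquad {}^\rho I^\alpha_{b-}h(x)=\frac{\rho^{1-\alpha}}{\Gamma(\alpha)}\int_x^b\frac{t^{\rho-1}}{(t^\rho-x^\rho)^{1-\alpha}}h(t)\,dt,$$ when the integrals exist. For $f$ defined on $[a^\rho,b^\rho]$, the notation ${}^\rho I^\alpha_{a+}f(b^\rho)$ means the left-sided integral of the function $h(x)=f(x^\rho)$ on $[a,b]$ evaluated at $x=b$, i.e. $\frac{\rho^{1-\alpha}}{\Gamma(\alpha)}\int_a^b\frac{t^{\rho-1}}{(b^\rho-t^\rho)^{1-\alpha}}f(t^\rho)\,dt$,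 and ${}^\rho I^\alpha_{b-}f(a^\rho)$ means the right-sided integral of the same function evaluated at $x=a$, i.e. $\frac{\rho^{1-\alpha}}{\Gamma(\alpha)}\int_a^b\frac{t^{\rho-1}}{(t^\rho-a^\rho)^{1-\alpha}}f(t^\rho)\,dt$. $\Gamma$ is Euler's gamma function. *)

theory Defs
  imports "HOL-Analysis.Analysis"
begin

text \<open>
  The integrals are Lebesgue integrals; as usual in HOL, a non-integrable integrand gives the
  value \<open>0\<close>. The conventions \<open>0 powr s = 0\<close> and \<open>y / 0 = 0\<close> only affect the integrands at the
  endpoints of the domain of integration.
\<close>

definition katugampola_left ::
    "real \<Rightarrow> real \<Rightarrow> real \<Rightarrow> (real \<Rightarrow> real) \<Rightarrow> real \<Rightarrow> real" where
  "katugampola_left \<rho> \<alpha> a h x =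
     \<rho> powr (1 - \<alpha>) / Gamma \<alpha> *
     (LINT t:{a..x}|lebesgue. t powr (\<rho> - 1) / (x powr \<rho> - t powr \<rho>) powr (1 - \<alpha>) * h t)"

definition katugampola_right ::
    "real \<Rightarrow> real \<Rightarrow> real \<Rightarrow> (real \<Rightarrow> real) \<Rightarrow> real \<Rightarrow> real" where
  "katugampola_right \<rho> \<alpha> b h x =
     \<rho> powr (1 - \<alpha>) / Gamma \<alpha> *
     (LINT t:{x..b}|lebesgue. t powr (\<rho> - 1) / (t powr \<rho> - x powr \<rho>) powr (1 - \<alpha>) * h t)"

end

(* The substitution s = t powr \<rho> turns both fractional integrals into averages of f over
   [A, B] = [a powr \<rho>, b powr \<rho>] against mutually reflected weights, so the chord L of f
   satisfies (f A + f B) / 2 = average of L.  With K = sup \<bar>f''\<bar> one has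
   \<bar>f s - L s\<bar> \<le> K / 2 * (s - A) * (B - s), and averaging gives the bound with the constant
   \<alpha> in place of \<alpha> + 1 / 2 powr \<alpha>.  With y the distance of s to the endpoint where the
   kernel is singular, multiplying the weight by y only raises \<alpha> by one, so the required
   moments all come from one integral. *)
theory Submission imports Defs begin

section \<open>Pointwise error of linear interpolation\<close>

text \<open>Adding the parabola \<open>K / 2 * (x - A) * (B - x)\<close>, whose second derivative is
  \<open>- K\<close>, to the difference of \<open>f\<close> and its chord gives a function with
  nonincreasing derivative. Such a function is concave, and as it vanishes at both endpoints it is
  nonnegative between them.\<close>

lemma chord_error_lower:
  fixes f :: "real \<Rightarrow> real"
  assumes "A < B" and cont: "continuous_on {A..B} f"
    and f1: "\<And>x. x \<in> {A<..<B} \<Longrightarrow> (f has_real_derivative f1 x) (at x)"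
    and f2: "\<And>x. x \<in> {A<..<B} \<Longrightarrow> (f1 has_real_derivative f2 x) (at x)"
    and K: "\<And>x. x \<in> {A<..<B} \<Longrightarrow> f2 x \<le> K"
    and s: "s \<in> {A..B}"
  shows "- (K / 2 * (s - A) * (B - s)) \<le> f s - (f B + (f A - f B) / (B - A) * (B - s))"
proof -
  define c where "c = (f A - f B) / (B - A)"
  define g where "g x = f x - (f B + c * (B - x)) + K / 2 * (x - A) * (B - x)" for x
  define g1 where "g1 x = f1 x + c + K / 2 * (A + B - 2 * x)" for x
  have cont_g: "continuous_on {A..B} g"
    unfolding g_def by (intro continuous_intros cont)
  have dg: "(g has_real_derivative g1 x) (at x)" if "x \<in> {A<..<B}" for x
    unfolding g_def g1_def
    by (auto intro!: derivative_eq_intros f1[OF that] simp: field_simps)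
  have dg1: "(g1 has_real_derivative f2 x - K) (at x)" if "x \<in> {A<..<B}" for x
    unfolding g1_def
    by (auto intro!: derivative_eq_intros f2[OF that] simp: field_simps)
  have ends: "g A = 0" "g B = 0"
    using \<open>A < B\<close> by (auto simp: g_def c_def)
  have g1_antimono: "g1 y \<le> g1 x" if "A < x" "x \<le> y" "y < B" for x y
    using that K
    by (intro DERIV_nonpos_imp_nonincreasing[of x y g1])
       (auto intro!: exI[of _ "f2 _ - K"] dg1)
  \<comment> \<open>If \<open>g s\<close> were negative, \<open>g\<close> would have to fall from
    its zero at \<open>A\<close> and climb back to its zero at \<open>B\<close>, so
    \<open>g1\<close> would be negative somewhere before \<open>s\<close> and positive somewhere
    after it. This contradicts \<open>g1_antimono\<close>.\<close>
  have "0 \<le> g s"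
  proof (rule ccontr)
    assume neg: "\<not> 0 \<le> g s"
    then have sAB: "A < s" "s < B"
      using s ends by (auto simp: le_less)
    \<comment> \<open>The mean value theorem asks only for continuity at the ends of the interval,
      so \<open>u = A\<close> and \<open>v = B\<close> are allowed although \<open>dg\<close> speaks
      of interior points.\<close>
    have mvt: "\<exists>z. u < z \<and> z < v \<and> g v - g u = (v - u) * g1 z"
      if "A \<le> u" "u < v" "v \<le> B" for u v
    proof -
      have "\<exists>l z. u < z \<and> z < v \<and> (g has_real_derivative l) (at z) \<and> g v - g u = (v - u) * l"
      proof (rule MVT)
        show "continuous_on {u..v} g"
          using cont_g that by (auto intro: continuous_on_subset)
        show "g differentiable (at x)" if "u < x" "x < v" for x
          using dg[of x] that \<open>A \<le> u\<close> \<open>v \<le> B\<close> by (auto simp: real_differentiable_def)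
      qed (use that in auto)
      then obtain l z where lz: "u < z" "z < v" "(g has_real_derivative l) (at z)"
        "g v - g u = (v - u) * l"
        by blast
      moreover have "l = g1 z"
        using DERIV_unique[OF lz(3) dg[of z]] lz(1,2) that by simp
      ultimately show ?thesis by blast
    qed
    obtain z where z: "A < z" "z < s" "g s - g A = (s - A) * g1 z"
      using mvt[of A s] sAB by auto
    obtain w where w: "s < w" "w < B" "g B - g s = (B - s) * g1 w"
      using mvt[of s B] sAB by auto
    have "(s - A) * g1 z < 0" "0 < (B - s) * g1 w"
      using z w neg ends by auto
    then have "g1 z < g1 w"
      using sAB by (simp add: mult_less_0_iff zero_less_mult_iff)
    then show False
      using g1_antimono[of z w] z w by simp
  qed
  then show ?thesis
    by (simp add: g_def c_def)
qed

text \<open>The one-sided estimate is applied to \<open>f\<close> and to \<open>- f\<close>: the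
  bound on the absolute value of \<open>f2\<close> bounds both \<open>f2\<close> and
  \<open>- f2\<close> from above.\<close>

lemma chord_error:
  fixes f :: "real \<Rightarrow> real"
  assumes "A < B" and cont: "continuous_on {A..B} f"
    and f1: "\<And>x. x \<in> {A<..<B} \<Longrightarrow> (f has_real_derivative f1 x) (at x)"
    and f2: "\<And>x. x \<in> {A<..<B} \<Longrightarrow> (f1 has_real_derivative f2 x) (at x)"
    and K: "\<And>x. x \<in> {A<..<B} \<Longrightarrow> \<bar>f2 x\<bar> \<le> K"
    and s: "s \<in> {A..B}"
  shows "\<bar>f s - (f B + (f A - f B) / (B - A) * (B - s))\<bar> \<le> K / 2 * (s - A) * (B - s)"
proof -
  have upper: "f2 x \<le> K" "- f2 x \<le> K" if "x \<in> {A<..<B}" for x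
    using K[OF that] by auto
  define c where "c = (f A - f B) / (B - A)"
  have neg: "(- f A - - f B) / (B - A) = - c"
    unfolding c_def by (simp only: minus_diff_minus minus_divide_left)
  have "- (K / 2 * (s - A) * (B - s)) \<le> f s - (f B + c * (B - s))"
    unfolding c_def by (rule chord_error_lower[OF \<open>A < B\<close> cont f1 f2 upper(1) s])
  moreover have "- (K / 2 * (s - A) * (B - s)) \<le> - f s - (- f B + - c * (B - s))"
    unfolding neg[symmetric]
    by (rule chord_error_lower[OF \<open>A < B\<close> continuous_on_minus[OF cont]
          DERIV_minus[OF f1] DERIV_minus[OF f2] upper(2) s])
  ultimately have "\<bar>f s - (f B + c * (B - s))\<bar> \<le> K / 2 * (s - A) * (B - s)"
    unfolding abs_le_iff by linarith
  then show ?thesis unfolding c_def .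
qed

section \<open>Averages against the singular weight\<close>

text \<open>Integrates the chord estimate against a weight. If \<open>y\<close> is the distance to
  one endpoint of an interval of length \<open>D\<close>, then the chord is affine in
  \<open>y\<close>, and the product of the distances to the two endpoints is
  \<open>D * y - y\<^sup>2\<close>. Hence only the moments of orders 0, 1 and 2 of \<open>y\<close>
  under \<open>w\<close> appear.\<close>

lemma weighted_quadratic_error:
  fixes w y g :: "real \<Rightarrow> real"
  assumes w: "\<And>t. t \<in> {a..b} \<Longrightarrow> 0 \<le> w t"
    and y: "continuous_on {a..b} y" and g: "continuous_on {a..b} g"
    and int: "set_integrable lebesgue {a..b} w"
    and bound: "\<And>t. t \<in> {a..b} \<Longrightarrow> \<bar>g t - (p + q * y t)\<bar> \<le> K / 2 * (D * y t - (y t)\<^sup>2)"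
  shows "\<bar>(LINT t:{a..b}|lebesgue. w t * g t)
           - (p * (LINT t:{a..b}|lebesgue. w t) + q * (LINT t:{a..b}|lebesgue. w t * y t))\<bar>
         \<le> K / 2 * (D * (LINT t:{a..b}|lebesgue. w t * y t)
                     - (LINT t:{a..b}|lebesgue. w t * (y t)\<^sup>2))"
proof -
  \<comment> \<open>The weight may be unbounded, so integrability of the product comes from
    \<open>h\<close> being bounded and measurable on the compact interval.\<close>
  have prod: "set_integrable lebesgue {a..b} (\<lambda>t. w t * h t)"
    if "continuous_on {a..b} h" for h :: "real \<Rightarrow> real"
  proof -
    have "set_integrable lebesgue {a..b} (\<lambda>t. h t * w t)"
      using that int
      by (intro absolutely_integrable_bounded_measurable_product_real
          continuous_imp_measurable_on_sets_lebesgue compact_imp_bounded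
          compact_continuous_image) auto
    then show ?thesis by (simp add: mult.commute)
  qed
  note [simp] = set_integral_diff set_integral_add
  have ints: "set_integrable lebesgue {a..b} (\<lambda>t. w t * y t)"
    "set_integrable lebesgue {a..b} (\<lambda>t. w t * (y t)\<^sup>2)"
    "set_integrable lebesgue {a..b} (\<lambda>t. w t * g t)"
    by (intro prod continuous_intros y g)+
  define r where "r t = g t - (p + q * y t)" for t
  have cont_r: "continuous_on {a..b} r"
    unfolding r_def by (intro continuous_intros y g)
  have "(LINT t:{a..b}|lebesgue. w t * r t) =
      (LINT t:{a..b}|lebesgue. w t * g t - (p * w t + q * (w t * y t)))"
    by (simp add: r_def algebra_simps)
  also have "\<dots> = (LINT t:{a..b}|lebesgue. w t * g t)
           - (p * (LINT t:{a..b}|lebesgue. w t) + q * (LINT t:{a..b}|lebesgue. w t * y t))"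
    using int ints by simp
  finally have eq: "(LINT t:{a..b}|lebesgue. w t * g t)
           - (p * (LINT t:{a..b}|lebesgue. w t) + q * (LINT t:{a..b}|lebesgue. w t * y t))
           = (LINT t:{a..b}|lebesgue. w t * r t)" ..
  have "\<bar>LINT t:{a..b}|lebesgue. w t * r t\<bar> \<le> (LINT t:{a..b}|lebesgue. \<bar>w t * r t\<bar>)"
    using set_integral_norm_bound[OF prod[OF cont_r]] by simp
  also have "\<dots> \<le> (LINT t:{a..b}|lebesgue. K / 2 * (D * (w t * y t) - w t * (y t)\<^sup>2))"
  proof (rule set_integral_mono)
    show "set_integrable lebesgue {a..b} (\<lambda>t. \<bar>w t * r t\<bar>)"
      using set_integrable_abs[OF prod[OF cont_r]] .
    show "set_integrable lebesgue {a..b} (\<lambda>t. K / 2 * (D * (w t * y t) - w t * (y t)\<^sup>2))"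
      using ints by simp
    fix t assume t: "t \<in> {a..b}"
    have "\<bar>w t * r t\<bar> = w t * \<bar>r t\<bar>"
      using w[OF t] by (simp add: abs_mult)
    also have "\<dots> \<le> w t * (K / 2 * (D * y t - (y t)\<^sup>2))"
      using w[OF t] bound[OF t] by (intro mult_left_mono) (auto simp: r_def)
    finally show "\<bar>w t * r t\<bar> \<le> K / 2 * (D * (w t * y t) - w t * (y t)\<^sup>2)"
      by (simp add: algebra_simps)
  qed
  also have "\<dots> = K / 2 * (D * (LINT t:{a..b}|lebesgue. w t * y t)
                     - (LINT t:{a..b}|lebesgue. w t * (y t)\<^sup>2))"
    using ints by simp
  finally show ?thesis unfolding eq .
qed

text \<open>By the chain rule, \<open>\<sigma> * y t powr \<beta> / (\<beta> * \<rho>)\<close> is an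
  antiderivative of the weight. The sign \<open>\<sigma>\<close> covers increasing and decreasing
  \<open>y\<close> at once, that is, the right- and the left-sided kernel, and the free exponent
  \<beta> serves all the moments.\<close>

lemma katugampola_weight:
  fixes y :: "real \<Rightarrow> real"
  assumes "\<beta> > 0" "\<rho> > 0" "a < b"
    and cont: "continuous_on {a..b} y"
    and pos: "\<And>t. t \<in> {a<..<b} \<Longrightarrow> 0 < y t"
    and dy: "\<And>t. t \<in> {a<..<b} \<Longrightarrow> (y has_real_derivative \<sigma> * \<rho> * t powr (\<rho> - 1)) (at t)"
    and \<sigma>: "\<sigma>\<^sup>2 = 1"
    and nonneg: "\<And>t. t \<in> {a..b} \<Longrightarrow> 0 \<le> y t"
  shows "set_integrable lebesgue {a..b} (\<lambda>t. t powr (\<rho> - 1) / y t powr (1 - \<beta>))"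
    and "(LINT t:{a..b}|lebesgue. t powr (\<rho> - 1) / y t powr (1 - \<beta>))
           = \<sigma> * (y b powr \<beta> - y a powr \<beta>) / (\<beta> * \<rho>)"
proof -
  let ?w = "\<lambda>t. t powr (\<rho> - 1) / y t powr (1 - \<beta>)"
  let ?F = "\<lambda>t. \<sigma> * y t powr \<beta> / (\<beta> * \<rho>)"
  \<comment> \<open>The weight can blow up at an endpoint, but since \<beta> is positive,
    \<open>?F\<close> stays continuous where \<open>y\<close> vanishes. The fundamental theorem with
    derivatives in the interior only therefore reaches the whole interval.\<close>
  have "(?w has_integral (?F b - ?F a)) {a..b}"
  proof (rule fundamental_theorem_of_calculus_interior)
    show "a \<le> b" using \<open>a < b\<close> by simp
    show "continuous_on {a..b} ?F"
      using assms by (intro continuous_intros continuous_on_powr') auto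
    fix t assume t: "t \<in> {a<..<b}"
    have "(?F has_real_derivative
        \<sigma> * (\<beta> * y t powr (\<beta> - 1) * (\<sigma> * \<rho> * t powr (\<rho> - 1))) / (\<beta> * \<rho>)) (at t)"
      using pos[OF t] dy[OF t]
      by (intro DERIV_cdivide DERIV_cmult DERIV_fun_powr[where r = \<beta>, simplified])
    moreover have "\<sigma> * (\<beta> * y t powr (\<beta> - 1) * (\<sigma> * \<rho> * t powr (\<rho> - 1))) / (\<beta> * \<rho>)
        = \<sigma>\<^sup>2 * (t powr (\<rho> - 1) * y t powr (\<beta> - 1))"
      using assms(1,2) by (simp add: field_simps power2_eq_square)
    moreover have "y t powr (\<beta> - 1) = 1 / y t powr (1 - \<beta>)"
      using powr_minus_divide[of "y t" "1 - \<beta>"] by simp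
    ultimately show "(?F has_vector_derivative ?w t) (at t)"
      using \<sigma> by (simp add: has_real_derivative_iff_has_vector_derivative)
  qed
  then have int: "?w integrable_on {a..b}" and val: "integral {a..b} ?w = ?F b - ?F a"
    by (auto simp: has_integral_iff)
  \<comment> \<open>The gauge integral of a nonnegative function is already a Lebesgue
    integral.\<close>
  show *: "set_integrable lebesgue {a..b} ?w"
    by (rule nonnegative_absolutely_integrable_1[OF int]) simp
  show "(LINT t:{a..b}|lebesgue. ?w t) = \<sigma> * (y b powr \<beta> - y a powr \<beta>) / (\<beta> * \<rho>)"
    using set_lebesgue_integral_eq_integral(2)[OF *] val
    by (simp add: diff_divide_distrib right_diff_distrib)
qed

text \<open>The factor \<open>\<alpha> * \<rho> / D powr \<alpha>\<close> gives the weight total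
  mass 1. Under this probability weight \<open>y\<close> has mean
  \<open>\<alpha> * D / (\<alpha> + 1)\<close> and \<open>y\<^sup>2\<close> has mean
  \<open>\<alpha> * D\<^sup>2 / (\<alpha> + 2)\<close>.\<close>

lemma katugampola_average_error:
  fixes y g :: "real \<Rightarrow> real"
  assumes "\<alpha> > 0" "\<rho> > 0" "a < b" "D > 0"
    and cont: "continuous_on {a..b} y"
    and pos: "\<And>t. t \<in> {a<..<b} \<Longrightarrow> 0 < y t"
    and dy: "\<And>t. t \<in> {a<..<b} \<Longrightarrow> (y has_real_derivative \<sigma> * \<rho> * t powr (\<rho> - 1)) (at t)"
    and ends: "\<sigma> = 1 \<and> y a = 0 \<and> y b = D \<or> \<sigma> = -1 \<and> y a = D \<and> y b = 0"
    and g: "continuous_on {a..b} g"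
    and bound: "\<And>t. t \<in> {a..b} \<Longrightarrow> \<bar>g t - (p + q * y t)\<bar> \<le> K / 2 * (D * y t - (y t)\<^sup>2)"
  shows "\<bar>\<alpha> * \<rho> / D powr \<alpha> * (LINT t:{a..b}|lebesgue. t powr (\<rho> - 1) / y t powr (1 - \<alpha>) * g t)
           - (p + q * (\<alpha> * D / (\<alpha> + 1)))\<bar>
         \<le> K * D\<^sup>2 * \<alpha> / (2 * (\<alpha> + 1) * (\<alpha> + 2))"
proof -
  let ?w = "\<lambda>t. t powr (\<rho> - 1) / y t powr (1 - \<alpha>)"
  have nonneg: "0 \<le> y t" if "t \<in> {a..b}" for t
    using pos[of t] that ends \<open>D > 0\<close> by (cases "t = a \<or> t = b") auto
  have \<sigma>: "\<sigma>\<^sup>2 = 1" using ends by auto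
  have moment: "(LINT t:{a..b}|lebesgue. t powr (\<rho> - 1) / y t powr (1 - \<beta>))
      = D powr \<beta> / (\<beta> * \<rho>)" if "\<beta> > 0" for \<beta>
    using katugampola_weight(2)[OF that \<open>\<rho> > 0\<close> \<open>a < b\<close> cont pos dy \<sigma> nonneg] ends that
    by auto
  \<comment> \<open>This holds even at the singular endpoint: for \<open>y t = 0\<close> the left
    side has a zero factor, and the right side is 0 by the conventions \<open>0 powr s = 0\<close>
    and \<open>x / 0 = 0\<close>.\<close>
  have raise: "x / y t powr (1 - \<beta>) * y t = x / y t powr (1 - (\<beta> + 1))"
    if "t \<in> {a..b}" for t x \<beta>
  proof (cases "y t = 0")
    case False
    then have "y t > 0" using nonneg[OF that] by simp
    then have "y t powr (1 - \<beta>) = y t powr (1 - (\<beta> + 1)) * y t"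
      using powr_add[of "y t" "1 - (\<beta> + 1)" 1] by simp
    with \<open>y t > 0\<close> show ?thesis by simp
  qed simp
  have m1: "(LINT t:{a..b}|lebesgue. ?w t * y t) = D powr (\<alpha> + 1) / ((\<alpha> + 1) * \<rho>)"
  proof -
    have "(LINT t:{a..b}|lebesgue. ?w t * y t)
        = (LINT t:{a..b}|lebesgue. t powr (\<rho> - 1) / y t powr (1 - (\<alpha> + 1)))"
      by (intro set_lebesgue_integral_cong) (use raise in auto)
    then show ?thesis using moment[of "\<alpha> + 1"] \<open>\<alpha> > 0\<close> by simp
  qed
  have m2: "(LINT t:{a..b}|lebesgue. ?w t * (y t)\<^sup>2) = D powr (\<alpha> + 2) / ((\<alpha> + 2) * \<rho>)"
  proof -
    have "?w t * (y t)\<^sup>2 = t powr (\<rho> - 1) / y t powr (1 - (\<alpha> + 2))" if "t \<in> {a..b}" for t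
      using raise[OF that, of "t powr (\<rho> - 1)" \<alpha>] raise[OF that, of "t powr (\<rho> - 1)" "\<alpha> + 1"]
      by (simp add: power2_eq_square mult.assoc[symmetric] add.assoc)
    then have "(LINT t:{a..b}|lebesgue. ?w t * (y t)\<^sup>2)
        = (LINT t:{a..b}|lebesgue. t powr (\<rho> - 1) / y t powr (1 - (\<alpha> + 2)))"
      by (intro set_lebesgue_integral_cong) auto
    then show ?thesis using moment[of "\<alpha> + 2"] \<open>\<alpha> > 0\<close> by simp
  qed
  define c where "c = \<alpha> * \<rho> / D powr \<alpha>"
  have c: "c > 0" using assms(1,2,4) by (simp add: c_def)
  define I where "I = (LINT t:{a..b}|lebesgue. ?w t * g t)"
  define E1 where "E1 = D powr (\<alpha> + 1) / ((\<alpha> + 1) * \<rho>)"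
  define E2 where "E2 = D powr (\<alpha> + 2) / ((\<alpha> + 2) * \<rho>)"
  define E0 where "E0 = D powr \<alpha> / (\<alpha> * \<rho>)"
  have c0: "c * E0 = 1"
    and c1: "c * E1 = \<alpha> * D / (\<alpha> + 1)"
    and c2: "c * E2 = \<alpha> * D\<^sup>2 / (\<alpha> + 2)"
    using assms(1,2,4) by (simp_all add: c_def E0_def E1_def E2_def powr_add)
  have "\<bar>I - (p * E0 + q * E1)\<bar> \<le> K / 2 * (D * E1 - E2)"
    using weighted_quadratic_error[OF _ cont g
        katugampola_weight(1)[OF \<open>\<alpha> > 0\<close> \<open>\<rho> > 0\<close> \<open>a < b\<close> cont pos dy \<sigma> nonneg] bound]
      moment[OF \<open>\<alpha> > 0\<close>] m1 m2
    by (simp add: I_def E0_def E1_def E2_def)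
  then have "c * \<bar>I - (p * E0 + q * E1)\<bar> \<le> c * (K / 2 * (D * E1 - E2))"
    using c by simp
  also have "c * \<bar>I - (p * E0 + q * E1)\<bar> = \<bar>c * (I - (p * E0 + q * E1))\<bar>"
    using c by (simp add: abs_mult)
  also have "c * (I - (p * E0 + q * E1)) = c * I - (p * (c * E0) + q * (c * E1))"
    by (simp only: right_diff_distrib distrib_left mult.left_commute)
  also have "c * (K / 2 * (D * E1 - E2)) = K / 2 * (D * (c * E1) - c * E2)"
    by (simp only: right_diff_distrib mult.left_commute)
  \<comment> \<open>The denominator arises from
    \<open>1 / (\<alpha> + 1) - 1 / (\<alpha> + 2)\<close>.\<close>
  also have "\<dots> = K * D\<^sup>2 * \<alpha> / (2 * (\<alpha> + 1) * (\<alpha> + 2))"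
    unfolding c1 c2
    using \<open>\<alpha> > 0\<close> by (simp add: divide_simps) (simp add: algebra_simps power2_eq_square)
  finally show ?thesis
    unfolding c0 c1 mult_1_right unfolding I_def c_def .
qed

section \<open>The trapezoid inequality for Katugampola integrals\<close>

theorem theorem2p2:
  fixes f :: "real \<Rightarrow> real" and a b \<alpha> \<rho> :: real
  assumes "\<alpha> > 0" and "\<rho> > 0" and "0 \<le> a" and "a < b"
    and "f differentiable_on {a powr \<rho>..b powr \<rho>}"
    and "deriv f differentiable_on {a powr \<rho><..<b powr \<rho>}"
  shows "ereal \<bar>(f (a powr \<rho>) + f (b powr \<rho>)) / 2
           - \<rho> powr \<alpha> * Gamma (\<alpha> + 1) / (2 * (b powr \<rho> - a powr \<rho>) powr \<alpha>)
             * (katugampola_left \<rho> \<alpha> a (\<lambda>x. f (x powr \<rho>)) b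
                + katugampola_right \<rho> \<alpha> b (\<lambda>x. f (x powr \<rho>)) a)\<bar>
         \<le> ereal ((b powr \<rho> - a powr \<rho>)\<^sup>2 / (2 * (\<alpha> + 1) * (\<alpha> + 2)) * (\<alpha> + 1 / 2 powr \<alpha>))
           * (SUP \<xi>\<in>{a powr \<rho><..<b powr \<rho>}. ereal \<bar>deriv (deriv f) \<xi>\<bar>)"
proof -
  define A B D where "A = a powr \<rho>" and "B = b powr \<rho>" and "D = B - A"
  have "A < B"
    using assms by (auto simp: A_def B_def intro!: powr_less_mono2)
  then have "D > 0" by (simp add: D_def)
  define Q where "Q = \<bar>(f A + f B) / 2 - \<rho> powr \<alpha> * Gamma (\<alpha> + 1) / (2 * D powr \<alpha>)
             * (katugampola_left \<rho> \<alpha> a (\<lambda>x. f (x powr \<rho>)) b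
                + katugampola_right \<rho> \<alpha> b (\<lambda>x. f (x powr \<rho>)) a)\<bar>"
  define C where "C = D\<^sup>2 / (2 * (\<alpha> + 1) * (\<alpha> + 2)) * (\<alpha> + 1 / 2 powr \<alpha>)"
  define S where "S = (SUP \<xi>\<in>{A<..<B}. ereal \<bar>deriv (deriv f) \<xi>\<bar>)"
  have "C > 0"
    unfolding C_def using \<open>D > 0\<close> \<open>\<alpha> > 0\<close> by (intro mult_pos_pos divide_pos_pos add_pos_pos) auto
  have bound: "ereal \<bar>deriv (deriv f) x\<bar> \<le> S" if "x \<in> {A<..<B}" for x
    unfolding S_def using that by (rule SUP_upper)
  have mid: "(A + B) / 2 \<in> {A<..<B}" using \<open>A < B\<close> by auto
  have "ereal Q \<le> ereal C * S"
  proof (cases S)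
    case PInf
    then show ?thesis using \<open>C > 0\<close> by simp
  next
    case MInf
    then show ?thesis using bound[OF mid] by simp
  next
    case (real K)
    then have K: "\<bar>deriv (deriv f) x\<bar> \<le> K" if "x \<in> {A<..<B}" for x
      using bound[OF that] by simp
    then have "K \<ge> 0" using mid by (meson abs_ge_zero order_trans)
    have cont_f: "continuous_on {A..B} f"
      using assms(5) by (simp add: A_def B_def differentiable_imp_continuous_on)
    have f1: "(f has_real_derivative deriv f x) (at x)" if "x \<in> {A<..<B}" for x
    proof -
      have "f differentiable_on {A<..<B}"
        using assms(5) by (rule differentiable_on_subset) (auto simp: A_def B_def)
      then have "f differentiable (at x within {A<..<B})"
        using that by (auto simp: differentiable_on_def)
      then show ?thesis
        using that by (simp add: at_within_open[of x "{A<..<B}"] DERIV_deriv_iff_real_differentiable)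
    qed
    have f2: "(deriv f has_real_derivative deriv (deriv f) x) (at x)" if "x \<in> {A<..<B}" for x
    proof -
      have "deriv f differentiable (at x within {A<..<B})"
        using assms(6) that by (auto simp: A_def B_def differentiable_on_def)
      then show ?thesis
        using that by (simp add: at_within_open[of x "{A<..<B}"] DERIV_deriv_iff_real_differentiable)
    qed
    have chord: "\<bar>f s - (f B + (f A - f B) / (B - A) * (B - s))\<bar> \<le> K / 2 * (s - A) * (B - s)"
      if "s \<in> {A..B}" for s
      by (rule chord_error[OF \<open>A < B\<close> cont_f f1 f2 K that])
    have range: "t powr \<rho> \<in> {A..B}" if "t \<in> {a..b}" for t
      using that assms(2,3) by (auto simp: A_def B_def intro!: powr_mono2)
    have cont_powr: "continuous_on {a..b} (\<lambda>t. t powr \<rho>)"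
      using assms(2,3) by (intro continuous_on_powr' continuous_intros) auto
    have cont_g: "continuous_on {a..b} (\<lambda>t. f (t powr \<rho>))"
      using range by (intro continuous_on_compose2[OF cont_f cont_powr]) auto
    have strict: "A < t powr \<rho>" "t powr \<rho> < B" if "t \<in> {a<..<b}" for t
      using that assms(2,3) by (auto simp: A_def B_def intro!: powr_less_mono2)
    have dpowr: "((\<lambda>t. t powr \<rho>) has_real_derivative \<rho> * t powr (\<rho> - 1)) (at t)"
      if "t \<in> {a<..<b}" for t
      using that assms(3) by (intro has_real_derivative_powr) auto
    define q where "q = (f A - f B) / D"
    have qD: "q * D = f A - f B" using \<open>D > 0\<close> by (simp add: q_def)
    define M where "M = K * D\<^sup>2 * \<alpha> / (2 * (\<alpha> + 1) * (\<alpha> + 2))"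
    define l where "l = \<alpha> * \<rho> / D powr \<alpha> * (LINT t:{a..b}|lebesgue.
        t powr (\<rho> - 1) / (B - t powr \<rho>) powr (1 - \<alpha>) * f (t powr \<rho>))"
    define r where "r = \<alpha> * \<rho> / D powr \<alpha> * (LINT t:{a..b}|lebesgue.
        t powr (\<rho> - 1) / (t powr \<rho> - A) powr (1 - \<alpha>) * f (t powr \<rho>))"
    have left: "\<bar>l - (f B + q * (\<alpha> * D / (\<alpha> + 1)))\<bar> \<le> M"
      unfolding l_def M_def
    proof (rule katugampola_average_error[where \<sigma> = "-1"])
      fix t assume t: "t \<in> {a..b}"
      show "\<bar>f (t powr \<rho>) - (f B + q * (B - t powr \<rho>))\<bar>
          \<le> K / 2 * (D * (B - t powr \<rho>) - (B - t powr \<rho>)\<^sup>2)"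
        using chord[OF range[OF t]]
        by (simp add: q_def D_def power2_eq_square algebra_simps)
    qed (use assms \<open>D > 0\<close> strict in
        \<open>auto simp: A_def B_def D_def intro!: continuous_intros cont_powr cont_g derivative_eq_intros dpowr\<close>)
    have right: "\<bar>r - (f A + - q * (\<alpha> * D / (\<alpha> + 1)))\<bar> \<le> M"
      unfolding r_def M_def
    proof (rule katugampola_average_error[where \<sigma> = 1])
      fix t assume t: "t \<in> {a..b}"
      have "f B + q * (B - t powr \<rho>) = f A + - q * (t powr \<rho> - A)"
        using qD by (simp add: D_def algebra_simps)
      moreover have "D * (t powr \<rho> - A) - (t powr \<rho> - A)\<^sup>2 = (t powr \<rho> - A) * (B - t powr \<rho>)"
        by (simp add: D_def power2_eq_square algebra_simps)
      ultimately show "\<bar>f (t powr \<rho>) - (f A + - q * (t powr \<rho> - A))\<bar>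
          \<le> K / 2 * (D * (t powr \<rho> - A) - (t powr \<rho> - A)\<^sup>2)"
        using chord[OF range[OF t], folded D_def, folded q_def] by (simp only: mult.assoc)
    qed (use assms \<open>D > 0\<close> strict in
        \<open>auto simp: A_def B_def D_def intro!: continuous_intros cont_powr cont_g derivative_eq_intros dpowr\<close>)
    have const: "\<rho> powr \<alpha> * Gamma (\<alpha> + 1) * (\<rho> powr (1 - \<alpha>) / Gamma \<alpha>) = \<alpha> * \<rho>"
    proof -
      have "Gamma (\<alpha> + 1) = \<alpha> * Gamma \<alpha>"
        using \<open>\<alpha> > 0\<close> by (intro Gamma_plus1) (auto elim: nonpos_Ints_cases)
      moreover have "Gamma \<alpha> \<noteq> 0" using Gamma_real_pos[OF \<open>\<alpha> > 0\<close>] by simp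
      moreover have "\<rho> powr \<alpha> * \<rho> powr (1 - \<alpha>) = \<rho>"
        using \<open>\<rho> > 0\<close> by (simp add: powr_add[symmetric])
      ultimately show ?thesis by simp
    qed
    have factor: "u / (2 * E) * (v * I + v * J) = (u * v / E * I + u * v / E * J) / 2"
      for u v E I J :: real
      by (simp add: algebra_simps add_divide_distrib)
    have "\<rho> powr \<alpha> * Gamma (\<alpha> + 1) / (2 * D powr \<alpha>)
             * (katugampola_left \<rho> \<alpha> a (\<lambda>x. f (x powr \<rho>)) b
                + katugampola_right \<rho> \<alpha> b (\<lambda>x. f (x powr \<rho>)) a) = (l + r) / 2"
      unfolding katugampola_left_def katugampola_right_def l_def r_def const[symmetric]
        A_def B_def
      by (rule factor)
    then have "Q = \<bar>(f A + f B) / 2 - (l + r) / 2\<bar>"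
      by (simp only: Q_def)
    also have "\<dots> \<le> M" using left right by (simp add: abs_le_iff) argo
    also have "M \<le> C * K"
    proof -
      have split: "x / N * (\<alpha> + e) * K = K * x * \<alpha> / N + K * x / N * e" for x N e :: real
        by (simp add: algebra_simps add_divide_distrib)
      have "C * K = M + K * D\<^sup>2 / (2 * (\<alpha> + 1) * (\<alpha> + 2)) * (1 / 2 powr \<alpha>)"
        unfolding C_def M_def by (rule split)
      then show ?thesis using \<open>K \<ge> 0\<close> \<open>\<alpha> > 0\<close> by simp
    qed
    finally show ?thesis using real by simp
  qed
  then show ?thesis
    by (simp add: Q_def C_def S_def D_def A_def B_def)
qed

end
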